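(* There is an algorithm for MinSet under stochastic explorable uncertainty restricted to instances whose sets are pairwise disjoint (disjoint MinSet) with competitive ratio at most $2/\tau$; i.e., for every such instance $J$ with balancing parameter $\tau>0$, $\mathbb{E}[\mathrm{ALG}(J)]\le \frac{2}{\tau}\,\mathbb{E}[\mathrm{OPT}(J)]$.
   Context: An instance of MinSet under stochastic explorable uncertainty consists of a finite set of uncertainty intervals $\mathcal{I}=\{I_1,\dots,I_n\}$ and a family $\mathcal{S}=\{S_1,\dots,S_m\}$ of subsets of $\mathcal{I}$. Each interval is either open, $I_i=(L_i,U_i)$ with $L_i<U_i$, or trivial, $I_i=\{w_i\}$ with $L_i=U_i=w_i$. Each $I_i$ has a value $w_i\in I_i$, drawn independently according to a distribution $d_i$ on $I_i$ which is unknown to the algorithm; querying $I_i$ reveals $w_i$. For $S\in\mathcal{S}$ let $w(S)=\sum_{I_i\in S}w_i$, and for a set $Q\subseteq\mathcal{I}$ of queried intervals let $L_S(Q)=\sum_{I_i\in S\setminus Q}L_i+\sum_{I_i\in S\cap Q}w_i$ and $U_S(Q)=\sum_{I_i\in S\setminus Q}U_i+\sum_{I_i\in S\cap Q}w_i$. Let $w^*=\min_{S\in\mathcal{S}}w(S)$. A set $Q\subseteq\mathcal{I}$ is feasible if there is $S^*\in\mathcal{S}$ with $L_{S^*}(Q)=U_{S^*}(Q)=w^*$ and $L_S(Q)\ge w^*$ for all $S\in\mathcal{S}$. An algorithm adaptively queries intervals until its set of queried intervals is feasible; $\mathrm{ALG}(J)$ is its number of queries on instance $J$, and $\mathrm{OPT}(J)$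 is the minimum cardinality of a feasible set for the realized values. For each $I_i$ let $\tau_i=\Pr[w_i\ge (U_i+L_i)/2]$; the balancing parameter is $\tau=\min_{I_i\in\mathcal{I}}\tau_i$. *)

theory Defs
  imports "HOL-Probability.Probability"
begin

text \<open>
  The part of an instance that is visible to the algorithm. Intervals are identified with their
  indices \<open>1, \<dots>, n\<close>, so that distinct intervals may share the same endpoints.
\<close>

record minset =
  num_intervals :: nat
  lower :: "nat \<Rightarrow> real"
  upper :: "nat \<Rightarrow> real"
  family :: "nat set set"

definition ground :: "minset \<Rightarrow> nat set" where
  "ground J = {1..num_intervals J}"

definition interval :: "minset \<Rightarrow> nat \<Rightarrow> real set" where
  "interval J i = (if lower J i < upper J i then {lower J i<..<upper J i} else {lower J i})"

text \<open>Non-emptiness of the ground set and of the family is what makes the two minima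
  \<open>\<tau>\<close> and \<open>w\<^sup>*\<close> meaningful.\<close>

definition minset_instance :: "minset \<Rightarrow> bool" where
  "minset_instance J \<longleftrightarrow>
     ground J \<noteq> {} \<and>
     (\<forall>i\<in>ground J. lower J i < upper J i \<or> lower J i = upper J i) \<and>
     family J \<noteq> {} \<and> family J \<subseteq> Pow (ground J)"

definition disjoint_minset_instance :: "minset \<Rightarrow> bool" where
  "disjoint_minset_instance J \<longleftrightarrow> minset_instance J \<and> disjoint (family J)"

definition realizations :: "minset \<Rightarrow> (nat \<Rightarrow> real) set" where
  "realizations J = PiE (ground J) (interval J)"

definition set_value :: "(nat \<Rightarrow> real) \<Rightarrow> nat set \<Rightarrow> real" where
  "set_value w S = (\<Sum>i\<in>S. w i)"

definition lower_limit :: "minset \<Rightarrow> (nat \<Rightarrow> real) \<Rightarrow> nat set \<Rightarrow> nat set \<Rightarrow> real" where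
  "lower_limit J w Q S = (\<Sum>i\<in>S - Q. lower J i) + (\<Sum>i\<in>S \<inter> Q. w i)"

definition upper_limit :: "minset \<Rightarrow> (nat \<Rightarrow> real) \<Rightarrow> nat set \<Rightarrow> nat set \<Rightarrow> real" where
  "upper_limit J w Q S = (\<Sum>i\<in>S - Q. upper J i) + (\<Sum>i\<in>S \<inter> Q. w i)"

definition min_value :: "minset \<Rightarrow> (nat \<Rightarrow> real) \<Rightarrow> real" where
  "min_value J w = Min (set_value w ` family J)"

definition feasible :: "minset \<Rightarrow> (nat \<Rightarrow> real) \<Rightarrow> nat set \<Rightarrow> bool" where
  "feasible J w Q \<longleftrightarrow>
     Q \<subseteq> ground J \<and>
     (\<exists>S\<in>family J. lower_limit J w Q S = min_value J w \<and> upper_limit J w Q S = min_value J w) \<and>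
     (\<forall>S\<in>family J. lower_limit J w Q S \<ge> min_value J w)"

definition OPT :: "minset \<Rightarrow> (nat \<Rightarrow> real) \<Rightarrow> nat" where
  "OPT J w = Min (card ` {Q. feasible J w Q})"

text \<open>
  A query strategy sees the intervals, the family and the list of queries made so far together
  with the revealed values, and returns the next interval to query. It has access neither to the
  values of unqueried intervals nor to the distributions.
\<close>

type_synonym strategy = "minset \<Rightarrow> (nat \<times> real) list \<Rightarrow> nat"

primrec history :: "strategy \<Rightarrow> minset \<Rightarrow> (nat \<Rightarrow> real) \<Rightarrow> nat \<Rightarrow> (nat \<times> real) list" where
  "history A J w 0 = []"
| "history A J w (Suc k) =
     history A J w k @ [(A J (history A J w k), w (A J (history A J w k)))]"

definition queried :: "strategy \<Rightarrow> minset \<Rightarrow> (nat \<Rightarrow> real) \<Rightarrow> nat \<Rightarrow> nat set" where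
  "queried A J w k = fst ` set (history A J w k)"

definition ALG :: "strategy \<Rightarrow> minset \<Rightarrow> (nat \<Rightarrow> real) \<Rightarrow> nat" where
  "ALG A J w = (LEAST k. feasible J w (queried A J w k))"

text \<open>
  Besides reaching a feasible set on every realization, which makes \<^const>\<open>ALG\<close> meaningful,
  the next query must be a measurable function of the values; without this the
  expected number of queries would not be well defined.
\<close>

definition algorithm_for :: "minset set \<Rightarrow> strategy \<Rightarrow> bool" where
  "algorithm_for \<J> A \<longleftrightarrow>
     (\<forall>J\<in>\<J>.
        (\<forall>h. A J h \<in> ground J) \<and>
        (\<forall>w\<in>realizations J. \<exists>k. feasible J w (queried A J w k)) \<and>
        (\<forall>k. (\<lambda>w. A J (history A J w k))
               \<in> measurable (PiM (ground J) (\<lambda>_. borel)) (count_space UNIV)))"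

definition value_distributions :: "minset \<Rightarrow> (nat \<Rightarrow> real measure) \<Rightarrow> bool" where
  "value_distributions J d \<longleftrightarrow>
     (\<forall>i\<in>ground J. real_distribution (d i) \<and> measure (d i) (interval J i) = 1)"

definition balancing_parameter :: "minset \<Rightarrow> (nat \<Rightarrow> real measure) \<Rightarrow> real" where
  "balancing_parameter J d =
     Min ((\<lambda>i. measure (d i) {x. x \<ge> (upper J i + lower J i) / 2}) ` ground J)"

definition expected :: "minset \<Rightarrow> (nat \<Rightarrow> real measure) \<Rightarrow> ((nat \<Rightarrow> real) \<Rightarrow> nat) \<Rightarrow> ennreal" where
  "expected J d X = (\<integral>\<^sup>+ w. of_nat (X w) \<partial>PiM (ground J) d)"

end

theory Submission
  imports Defs
begin

text \<open>
  The algorithm repeatedly queries the widest unqueried interval of a set with minimum current lower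
  limit, until such a set has no non-trivial unqueried interval. As long as this has not
  happened, the lower limit of the chosen set is below \<open>w\<^sup>*\<close>, so every feasible \<open>Q\<close> still
  has to contain further elements of that set. Counting the elements of \<open>Q\<close> in halves,
  each query that reveals a value in the upper half of its interval makes one of these halves
  superfluous; hence on every realization at most \<open>2 OPT\<close> queries are of this kind. The decision to
  query \<open>i\<close> is independent of \<open>w i\<close>, so the expected number of such queries is at least \<open>\<tau>\<close> times
  the expected number of all queries.
\<close>

section \<open>The widest-first strategy and its run\<close>

definition minimizers :: "minset \<Rightarrow> (nat \<Rightarrow> real) \<Rightarrow> nat set \<Rightarrow> nat set set" where
  "minimizers J w Q =
     {S \<in> family J. \<forall>S'\<in>family J. lower_limit J w Q S \<le> lower_limit J w Q S'}"

text \<open>Keeping \<open>M\<close> as a parameter here, in \<open>widest\<close> and in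
  \<open>pick\<close> makes the dependence on the values pass through the minimizers alone. As these
  range over a finite set, measurability and locality of each decision reduce to facts about
  \<open>minimizers\<close>.\<close>

definition settled :: "minset \<Rightarrow> nat set \<Rightarrow> nat set set \<Rightarrow> bool" where
  "settled J Q M \<longleftrightarrow> (\<exists>S\<in>M. \<forall>i\<in>S - Q. lower J i = upper J i)"

definition width :: "minset \<Rightarrow> nat \<Rightarrow> real" where
  "width J i = upper J i - lower J i"

definition widest :: "minset \<Rightarrow> nat set \<Rightarrow> nat set set \<Rightarrow> nat \<Rightarrow> bool" where
  "widest J Q M i \<longleftrightarrow> (\<exists>S\<in>M. i \<in> S - Q \<and> (\<forall>l\<in>S - Q. width J l \<le> width J i))"

text \<open>A strategy has to name an interval of the instance after every history, even when there
  is no candidate left. The default 1 lies in every nonempty ground set.\<close>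

definition pick :: "minset \<Rightarrow> nat set \<Rightarrow> nat set set \<Rightarrow> nat" where
  "pick J Q M = (if \<exists>i. widest J Q M i then SOME i. widest J Q M i else 1)"

definition widest_first :: strategy where
  "widest_first J h =
     pick J (fst ` set h) (minimizers J (\<lambda>i. the (map_of h i)) (fst ` set h))"

text \<open>In contrast to the strategy, which goes on forever, the step does nothing once settled.
  Hence every change of the run adds a new interval.\<close>

definition step :: "minset \<Rightarrow> (nat \<Rightarrow> real) \<Rightarrow> nat set \<Rightarrow> nat set" where
  "step J w Q = (if settled J Q (minimizers J w Q) then Q
     else insert (pick J Q (minimizers J w Q)) Q)"

definition run :: "minset \<Rightarrow> (nat \<Rightarrow> real) \<Rightarrow> nat \<Rightarrow> nat set" where
  "run J w k = (step J w ^^ k) {}"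

text \<open>Each unsettled step adds a new element of the ground set, so
  \<open>num_intervals J\<close> steps always reach the point where the run is settled.\<close>

definition final :: "minset \<Rightarrow> (nat \<Rightarrow> real) \<Rightarrow> nat set" where
  "final J w = run J w (num_intervals J)"

definition upper_half :: "minset \<Rightarrow> (nat \<Rightarrow> real) \<Rightarrow> nat set" where
  "upper_half J w = {i. w i \<ge> (upper J i + lower J i) / 2}"

section \<open>Elementary properties of instances and of the chosen query\<close>

lemma run_0 [simp]: "run J w 0 = {}"
  and run_Suc [simp]: "run J w (Suc k) = step J w (run J w k)"
  by (simp_all add: run_def)

lemma finite_ground [simp]: "finite (ground J)"
  by (simp add: ground_def)

lemma card_ground [simp]: "card (ground J) = num_intervals J"
  by (simp add: ground_def)

lemma instance_finite:
  assumes "minset_instance J"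
  shows "finite (family J)" and "S \<in> family J \<Longrightarrow> finite S"
  using assms finite_subset[of "family J" "Pow (ground J)"] finite_subset[OF _ finite_ground]
  by (auto simp: minset_instance_def)

lemma instance_le:
  assumes "minset_instance J" "i \<in> ground J"
  shows "lower J i \<le> upper J i"
  using assms by (force simp: minset_instance_def)

lemma lower_limit_cong:
  assumes "\<And>i. i \<in> Q \<Longrightarrow> w i = w' i"
  shows "lower_limit J w Q S = lower_limit J w' Q S"
  using assms by (auto simp: lower_limit_def intro!: sum.cong)

lemma minimizers_cong:
  assumes "\<And>i. i \<in> Q \<Longrightarrow> w i = w' i"
  shows "minimizers J w Q = minimizers J w' Q"
  using lower_limit_cong[OF assms] by (simp add: minimizers_def)

lemma minimizers_nonempty:
  assumes "minset_instance J"
  shows "minimizers J w Q \<noteq> {}"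
proof -
  have "finite (lower_limit J w Q ` family J)" "lower_limit J w Q ` family J \<noteq> {}"
    using assms instance_finite by (auto simp: minset_instance_def)
  from Min_in[OF this] Min_le[OF this(1)] show ?thesis
    unfolding minimizers_def by fastforce
qed

lemma widest_pick:
  assumes J: "minset_instance J" and ns: "\<not> settled J Q (minimizers J w Q)"
  shows "widest J Q (minimizers J w Q) (pick J Q (minimizers J w Q))"
proof -
  obtain S where S: "S \<in> minimizers J w Q" using minimizers_nonempty[OF J] by blast
  have fin: "finite (width J ` (S - Q))"
    using S instance_finite[OF J] by (auto simp: minimizers_def)
  have "width J ` (S - Q) \<noteq> {}" using ns S by (auto simp: settled_def)
  from Max_ge[OF fin] Max_in[OF fin this]
  obtain i where "i \<in> S - Q" "\<forall>l\<in>S - Q. width J l \<le> width J i" by fastforce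
  then have "widest J Q (minimizers J w Q) i" using S by (auto simp: widest_def)
  then show ?thesis unfolding pick_def by (metis someI)
qed

lemma pick_in_ground:
  assumes J: "minset_instance J" and M: "M \<subseteq> family J"
  shows "pick J Q M \<in> ground J"
proof (cases "\<exists>i. widest J Q M i")
  case True
  then have "widest J Q M (pick J Q M)" by (auto simp: pick_def intro: someI)
  then show ?thesis using J M by (auto simp: widest_def minset_instance_def)
next
  case False
  then show ?thesis using J by (auto simp: pick_def minset_instance_def ground_def)
qed

lemma minimizers_subset: "minimizers J w Q \<subseteq> family J"
  by (auto simp: minimizers_def)

lemma run_subset_ground:
  assumes "minset_instance J"
  shows "run J w k \<subseteq> ground J"
  using pick_in_ground[OF assms minimizers_subset]
  by (induction k) (auto simp: step_def)

section \<open>The run as a prefix of the query sequence\<close>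

lemma map_of_history:
  assumes "i \<in> queried A J w k"
  shows "the (map_of (history A J w k) i) = w i"
proof -
  \<comment> \<open>All entries recorded for \<open>l\<close> carry the same value, so it does not
    matter which of them \<open>map_of\<close> finds.\<close>
  have "v = w l" if "(l, v) \<in> set (history A J w k)" for l v
    using that by (induction k) auto
  moreover have "map_of (history A J w k) i \<noteq> None"
    using assms by (simp add: map_of_eq_None_iff queried_def)
  ultimately show ?thesis using map_of_SomeD by fastforce
qed

lemma widest_first_history:
  "widest_first J (history A J w k) =
     pick J (queried A J w k) (minimizers J w (queried A J w k))"
proof -
  have "minimizers J (\<lambda>i. the (map_of (history A J w k) i)) (queried A J w k) =
    minimizers J w (queried A J w k)" by (rule minimizers_cong) (rule map_of_history)
  then show ?thesis by (simp add: widest_first_def queried_def)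
qed

lemma queried_Suc:
  "queried widest_first J w (Suc k) =
     insert (pick J (queried widest_first J w k) (minimizers J w (queried widest_first J w k)))
       (queried widest_first J w k)"
  using widest_first_history[of J widest_first w k] by (simp add: queried_def)

text \<open>Strategy and run make the same queries until the run is settled. Before that no interval
  is queried twice, so the time \<open>j\<close> equals the number of queried intervals; this lets a
  cardinality stand in for the number of queries.\<close>

lemma run_queried:
  assumes J: "minset_instance J"
  shows "\<exists>j\<le>k. run J w k = queried widest_first J w j \<and> card (run J w k) = j \<and>
    (j < k \<longrightarrow> settled J (run J w k) (minimizers J w (run J w k)))"
proof (induction k)
  case 0
  then show ?case by (simp add: queried_def)
next
  case (Suc k)
  then obtain j where j: "j \<le> k" "run J w k = queried widest_first J w j" "card (run J w k) = j"
    "j < k \<longrightarrow> settled J (run J w k) (minimizers J w (run J w k))" by blast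
  show ?case
  proof (cases "settled J (run J w k) (minimizers J w (run J w k))")
    case True
    then show ?thesis using j by (intro exI[of _ j]) (auto simp: step_def)
  next
    case False
    then have "j = k" using j by auto
    moreover have "pick J (run J w k) (minimizers J w (run J w k)) \<notin> run J w k"
      using widest_pick[OF J False] by (auto simp: widest_def)
    moreover have "finite (run J w k)"
      using run_subset_ground[OF J] finite_ground finite_subset by blast
    ultimately show ?thesis using j False
      by (intro exI[of _ "Suc j"]) (auto simp: step_def queried_Suc)
  qed
qed

lemma settled_final:
  assumes J: "minset_instance J"
  shows "settled J (final J w) (minimizers J w (final J w))"
    and "\<exists>j. final J w = queried widest_first J w j \<and> card (final J w) = j"
proof -
  from run_queried[OF J, of "num_intervals J" w]
  obtain j where j: "j \<le> num_intervals J" "final J w = queried widest_first J w j"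
    "card (final J w) = j"
    "j < num_intervals J \<longrightarrow> settled J (final J w) (minimizers J w (final J w))"
    unfolding final_def by blast
  have sub: "final J w \<subseteq> ground J" using run_subset_ground[OF J] by (simp add: final_def)
  show "settled J (final J w) (minimizers J w (final J w))"
  proof (cases "j < num_intervals J")
    case False
    \<comment> \<open>If no step was idle, all intervals have been queried, and then any minimizer
      is settled vacuously.\<close>
    then have "final J w = ground J"
      using j sub card_subset_eq[OF finite_ground sub] by simp
    moreover obtain S where "S \<in> minimizers J w (ground J)"
      using minimizers_nonempty[OF J] by blast
    moreover from this have "S - ground J = {}"
      using minimizers_subset J by (fastforce simp: minset_instance_def)
    ultimately show ?thesis unfolding settled_def by (metis empty_iff)
  qed (use j in auto)
  show "\<exists>j. final J w = queried widest_first J w j \<and> card (final J w) = j"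
    using j by auto
qed

section \<open>Lower limits, settled sets and feasibility\<close>

lemma realization_bounds:
  assumes "minset_instance J" "w \<in> realizations J" "i \<in> ground J"
  shows "lower J i \<le> w i" "w i \<le> upper J i" "lower J i \<noteq> upper J i \<Longrightarrow> lower J i < w i"
    "lower J i = upper J i \<Longrightarrow> w i = lower J i"
proof -
  have "w i \<in> interval J i" using assms by (auto simp: realizations_def)
  then show "lower J i \<le> w i" "w i \<le> upper J i" "lower J i \<noteq> upper J i \<Longrightarrow> lower J i < w i"
    "lower J i = upper J i \<Longrightarrow> w i = lower J i"
    using instance_le[OF assms(1,3)] by (auto simp: interval_def split: if_splits)
qed

lemma lower_limit_alt:
  assumes "finite S"
  shows "lower_limit J w Q S = (\<Sum>i\<in>S. if i \<in> Q then w i else lower J i)"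
  using assms by (simp add: lower_limit_def sum.If_cases Diff_eq)

lemma lower_limit_le_value:
  assumes J: "minset_instance J" and w: "w \<in> realizations J" and S: "S \<in> family J"
  shows "lower_limit J w Q S \<le> set_value w S"
  unfolding lower_limit_alt[OF instance_finite(2)[OF J S]] set_value_def
  using S J realization_bounds(1)[OF J w] by (intro sum_mono) (auto simp: minset_instance_def)

text \<open>The difference of the two sides is a sum of nonnegative terms, one for each element of
  \<open>S\<close>. The term of an unqueried non-trivial interval is strictly positive because the
  interval is open.\<close>

lemma lower_limit_eq_value_iff:
  assumes J: "minset_instance J" and w: "w \<in> realizations J" and S: "S \<in> family J"
  shows "lower_limit J w Q S = set_value w S \<longleftrightarrow> (\<forall>i\<in>S - Q. lower J i = upper J i)"
proof -
  have SG: "i \<in> ground J" if "i \<in> S" for i using that S J by (auto simp: minset_instance_def)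
  have "lower_limit J w Q S = set_value w S \<longleftrightarrow>
    (\<Sum>i\<in>S. w i - (if i \<in> Q then w i else lower J i)) = 0"
    unfolding lower_limit_alt[OF instance_finite(2)[OF J S]] set_value_def sum_subtractf by auto
  also have "\<dots> \<longleftrightarrow> (\<forall>i\<in>S. w i - (if i \<in> Q then w i else lower J i) = 0)"
    using instance_finite(2)[OF J S] realization_bounds[OF J w SG]
    by (intro sum_nonneg_eq_0_iff) auto
  also have "\<dots> \<longleftrightarrow> (\<forall>i\<in>S - Q. lower J i = upper J i)"
    using realization_bounds(3,4)[OF J w SG] by (auto split: if_splits) force+
  finally show ?thesis .
qed

lemma upper_limit_eq_lower_limit:
  assumes "\<forall>i\<in>S - Q. lower J i = upper J i"
  shows "upper_limit J w Q S = lower_limit J w Q S"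
  using assms by (simp add: upper_limit_def lower_limit_def)

lemma min_value_attained:
  assumes J: "minset_instance J"
  obtains S where "S \<in> family J" "set_value w S = min_value J w"
proof -
  have "min_value J w \<in> set_value w ` family J"
    unfolding min_value_def using J instance_finite[OF J]
    by (intro Min_in) (auto simp: minset_instance_def)
  then show ?thesis using that by auto
qed

lemma min_value_le:
  assumes "minset_instance J" "S \<in> family J"
  shows "min_value J w \<le> set_value w S"
  unfolding min_value_def using assms instance_finite by auto

text \<open>The lower limit of a settled minimizer is its true value, hence at least w*. Being
  minimal, it is also at most the lower limit of an optimal set, hence at most w*.\<close>

lemma settled_imp_feasible:
  assumes J: "minset_instance J" and w: "w \<in> realizations J" and Q: "Q \<subseteq> ground J"
    and s: "settled J Q (minimizers J w Q)"
  shows "feasible J w Q"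
proof -
  obtain S where S: "S \<in> family J" "\<forall>S'\<in>family J. lower_limit J w Q S \<le> lower_limit J w Q S'"
    "\<forall>i\<in>S - Q. lower J i = upper J i"
    using s by (auto simp: settled_def minimizers_def)
  obtain T where T: "T \<in> family J" "set_value w T = min_value J w"
    using min_value_attained[OF J] .
  have "lower_limit J w Q S = set_value w S"
    using lower_limit_eq_value_iff[OF J w S(1)] S(3) by blast
  moreover have "lower_limit J w Q S \<le> min_value J w"
    using S(2) T lower_limit_le_value[OF J w T(1)] by (metis order_trans)
  ultimately have "lower_limit J w Q S = min_value J w" using min_value_le[OF J S(1), of w] by simp
  then show ?thesis
    using S Q upper_limit_eq_lower_limit[OF S(3), of w] by (auto simp: feasible_def)
qed

text \<open>If the smallest lower limit had reached w*, an optimal set \<open>T\<close> would be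
  squeezed: its lower limit would equal its value. Then \<open>T\<close> would be a minimizer with
  only trivial unqueried intervals, so the run would be settled.\<close>

lemma not_settled_imp_less:
  assumes J: "minset_instance J" and w: "w \<in> realizations J"
    and s: "\<not> settled J Q (minimizers J w Q)" and S: "S \<in> minimizers J w Q"
  shows "lower_limit J w Q S < min_value J w"
proof (rule ccontr)
  assume "\<not> ?thesis"
  then have *: "min_value J w \<le> lower_limit J w Q S'" if "S' \<in> family J" for S'
    using S that by (force simp: minimizers_def)
  obtain T where T: "T \<in> family J" "set_value w T = min_value J w"
    using min_value_attained[OF J] .
  have eq: "lower_limit J w Q T = set_value w T"
    using *[OF T(1)] T lower_limit_le_value[OF J w T(1), of Q] by simp
  then have "T \<in> minimizers J w Q" using T * by (auto simp: minimizers_def)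
  moreover have "\<forall>i\<in>T - Q. lower J i = upper J i"
    using lower_limit_eq_value_iff[OF J w T(1)] eq by blast
  ultimately show False using s by (auto simp: settled_def)
qed

section \<open>The potential argument against a feasible set\<close>

lemma lower_limit_insert:
  assumes "finite S" "i \<notin> Q"
  shows "lower_limit J w (insert i Q) S =
    lower_limit J w Q S + (if i \<in> S then w i - lower J i else 0)"
proof -
  have "(\<Sum>l\<in>S. if l \<in> insert i Q then w l else lower J l) =
    (\<Sum>l\<in>S. (if l \<in> Q then w l else lower J l) + (if l = i then w i - lower J i else 0))"
    using assms by (intro sum.cong) auto
  then show ?thesis using assms by (simp add: lower_limit_alt sum.distrib)
qed

text \<open>The potential \<open>x\<close> counts half-units of the queries of \<open>Q\<close> still needed to cover what the
  run has not yet covered. A query \<open>i\<close> whose value lies in the upper half pays for half of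
  any other unqueried element of the same set, because \<open>i\<close> is the widest one.\<close>

lemma run_potential:
  assumes D: "disjoint_minset_instance J" and w: "w \<in> realizations J" and Q: "feasible J w Q"
  shows "\<exists>x :: nat \<Rightarrow> nat. (\<forall>i\<in>run J w k. x i = 0) \<and> (\<forall>i. x i \<le> 2) \<and>
    (\<forall>S\<in>family J. min_value J w \<le>
       lower_limit J w (run J w k) S + (\<Sum>i\<in>S. real (x i) / 2 * (w i - lower J i))) \<and>
    sum x (ground J) + card (run J w k \<inter> upper_half J w) \<le> 2 * card Q"
proof (induction k)
  case 0
  have J: "minset_instance J" using D by (simp add: disjoint_minset_instance_def)
  have QG: "Q \<subseteq> ground J" using Q by (simp add: feasible_def)
  \<comment> \<open>Every query of \<open>Q\<close> starts with two half-units, that is, with full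
    weight; this turns the lower limits for no queries into those for \<open>Q\<close>.\<close>
  let ?x = "\<lambda>i. if i \<in> Q then 2 else (0::nat)"
  have "sum ?x (ground J) = 2 * card Q"
    using QG by (simp add: sum.If_cases Int_absorb1)
  moreover have "min_value J w \<le> lower_limit J w {} S +
    (\<Sum>i\<in>S. real (?x i) / 2 * (w i - lower J i))" if S: "S \<in> family J" for S
  proof -
    have "lower_limit J w {} S + (\<Sum>i\<in>S. real (?x i) / 2 * (w i - lower J i)) = lower_limit J w Q S"
      unfolding lower_limit_alt[OF instance_finite(2)[OF J S]] sum.distrib[symmetric]
      by (intro sum.cong) (auto simp: field_simps)
    then show ?thesis using Q S by (simp add: feasible_def)
  qed
  ultimately show ?case by (intro exI[of _ ?x]) auto
next
  case (Suc k)
  have J: "minset_instance J" and disj: "disjoint (family J)"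
    using D by (simp_all add: disjoint_minset_instance_def)
  let ?R = "run J w k"
  let ?M = "minimizers J w ?R"
  let ?g = "\<lambda>i. w i - lower J i"
  obtain x :: "nat \<Rightarrow> nat" where x0: "\<And>i. i \<in> ?R \<Longrightarrow> x i = 0" and x2: "\<And>i. x i \<le> 2"
    and cover: "\<And>S. S \<in> family J \<Longrightarrow>
      min_value J w \<le> lower_limit J w ?R S + (\<Sum>i\<in>S. real (x i) / 2 * ?g i)"
    and bound: "sum x (ground J) + card (?R \<inter> upper_half J w) \<le> 2 * card Q"
    using Suc.IH by blast
  show ?case
  proof (cases "settled J ?R ?M")
    case True
    then have "run J w (Suc k) = ?R" by (simp add: step_def)
    then show ?thesis using Suc.IH by simp
  next
    case False
    define i where "i = pick J ?R ?M"
    have run: "run J w (Suc k) = insert i ?R" using False by (simp add: step_def i_def)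
    obtain S where S: "S \<in> ?M" "i \<in> S" "i \<notin> ?R"
      and wid: "\<And>l. l \<in> S \<Longrightarrow> l \<notin> ?R \<Longrightarrow> width J l \<le> width J i"
      using widest_pick[OF J False] unfolding i_def[symmetric] by (auto simp: widest_def)
    have SF: "S \<in> family J" using S by (simp add: minimizers_def)
    have fin: "finite S'" if "S' \<in> family J" for S' using instance_finite(2)[OF J that] .
    have SG: "S \<subseteq> ground J" using SF J by (auto simp: minset_instance_def)
    have g0: "0 \<le> ?g l" "?g l \<le> width J l" if "l \<in> S" for l
      using realization_bounds[OF J w, of l] SG that by (auto simp: width_def)
    have finR: "finite (?R \<inter> upper_half J w)"
      using run_subset_ground[OF J] finite_ground finite_subset by blast
    \<comment> \<open>Disjointness enters here: lowering the weight of an element of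
      \<open>S\<close> cannot spoil the inequality of another set.\<close>
    have only: "S' = S" if "S' \<in> family J" "l \<in> S'" "l \<in> S" for S' l
      using disj that SF unfolding disjoint_def by blast
    \<comment> \<open>One update covers both cases below: \<open>c\<close> half-units are taken from
      \<open>l\<close>. Querying \<open>i\<close> raises the lower limit of \<open>S\<close> by
      \<open>?g i\<close>, which by \<open>paid\<close> makes up for the loss. The conditions
      relating \<open>l\<close>, \<open>i\<close> and \<open>c\<close> leave \<open>i\<close> with
      weight 0, and \<open>c\<close> is at least 1 whenever the count of upper-half queries
      grows.\<close>
    have main: ?thesis
      if l: "l \<in> S" "c \<le> x l" "l = i \<longrightarrow> c = x i" "l \<noteq> i \<longrightarrow> x i = 0"
        and paid: "real c / 2 * ?g l \<le> ?g i" and c: "i \<in> upper_half J w \<Longrightarrow> 1 \<le> c" for l c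
    proof -
      let ?y = "x(l := x l - c)"
      have y: "real (?y j) / 2 * ?g j = real (x j) / 2 * ?g j - (if j = l then real c / 2 * ?g l else 0)" for j
        using l(2) by (auto simp: of_nat_diff field_simps)
      have "sum x (ground J) = sum ?y (ground J) + c"
      proof -
        have "sum x (ground J) = sum (\<lambda>j. ?y j + (if j = l then c else 0)) (ground J)"
          using l(2) by (intro sum.cong) auto
        then show ?thesis using l(1) SG by (simp only: sum.distrib) auto
      qed
      moreover have "card (insert i ?R \<inter> upper_half J w) \<le> card (?R \<inter> upper_half J w) + c"
        using c finR S(3) by (cases "i \<in> upper_half J w") auto
      ultimately have b: "sum ?y (ground J) + card (insert i ?R \<inter> upper_half J w) \<le> 2 * card Q"
        using bound by simp
      have "min_value J w \<le> lower_limit J w (insert i ?R) T + (\<Sum>j\<in>T. real (?y j) / 2 * ?g j)"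
        if T: "T \<in> family J" for T
      proof (cases "T = S")
        case True
        then show ?thesis
          unfolding y lower_limit_insert[OF fin[OF T] S(3)] sum_subtractf
          using cover[OF T] paid l(1) S(2) fin[OF T] by simp
      next
        case False
        then have "l \<notin> T" "i \<notin> T" using only[OF T] l(1) S(2) by blast+
        then show ?thesis
          unfolding y lower_limit_insert[OF fin[OF T] S(3)] sum_subtractf
          using cover[OF T] fin[OF T] by simp
      qed
      moreover have "?y j = 0" if "j \<in> insert i ?R" for j
        using that x0 l by (cases "j = l") auto
      moreover have "?y j \<le> 2" for j using x2[of j] x2[of l] by (simp add: le_diff_conv trans_le_add1)
      ultimately show ?thesis using b unfolding run by (intro exI[of _ ?y] conjI ballI allI)
    qed
    \<comment> \<open>If \<open>i\<close> has weight left, or its value is low, take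
      \<open>l = i\<close> and remove all of its weight. Otherwise a half-unit must come from
      another element of \<open>S\<close>.\<close>
    show ?thesis
    proof (cases "x i > 0 \<or> i \<notin> upper_half J w")
      case True
      have paid: "real (x i) / 2 * ?g i \<le> 1 * ?g i"
        using x2[of i] g0[OF S(2)] by (intro mult_right_mono) auto
      show ?thesis by (rule main[of i "x i"]) (use S(2) True paid in auto)
    next
      case False
      \<comment> \<open>The lower limit of \<open>S\<close> is still below w*, so some
        \<open>l\<close> in \<open>S\<close> has positive weight. It is unqueried by
        \<open>x0\<close>, and it is not \<open>i\<close>, whose weight is 0 in this case.\<close>
      have "0 < (\<Sum>j\<in>S. real (x j) / 2 * ?g j)"
        using cover[OF SF] not_settled_imp_less[OF J w \<open>\<not> settled J ?R ?M\<close> S(1)] by simp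
      then have "\<exists>l\<in>S. x l \<noteq> 0"
        by (metis (no_types, lifting) div_0 less_irrefl mult_zero_left of_nat_0 sum.neutral)
      then obtain l where l: "l \<in> S" "x l \<noteq> 0" by blast
      then have "width J l \<le> width J i" using wid[of l] x0[of l] by auto
      moreover have "width J i \<le> 2 * ?g i"
        using False by (simp add: upper_half_def width_def field_simps)
      \<comment> \<open>A value in the upper half gains at least half the width of \<open>i\<close>.
        As \<open>i\<close> is widest, this is at least half of what \<open>l\<close> could
        contribute.\<close>
      ultimately have paid: "?g l / 2 \<le> ?g i" using g0[OF l(1)] by simp
      show ?thesis by (rule main[of l 1]) (use l False paid in auto)
    qed
  qed
qed


lemma card_final_upper_half:
  assumes "disjoint_minset_instance J" "w \<in> realizations J" "feasible J w Q"
  shows "card (final J w \<inter> upper_half J w) \<le> 2 * card Q"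
  using run_potential[OF assms, of "num_intervals J"] by (auto simp: final_def)

lemma feasible_final:
  assumes J: "minset_instance J" and w: "w \<in> realizations J"
  shows "feasible J w (final J w)"
  using settled_imp_feasible[OF J w _ settled_final(1)[OF J]] run_subset_ground[OF J]
  by (simp add: final_def)

lemma card_final_upper_half_le_OPT:
  assumes D: "disjoint_minset_instance J" and w: "w \<in> realizations J"
  shows "card (final J w \<inter> upper_half J w) \<le> 2 * OPT J w"
proof -
  have J: "minset_instance J" using D by (simp add: disjoint_minset_instance_def)
  have "{Q. feasible J w Q} \<subseteq> Pow (ground J)" by (auto simp: feasible_def)
  then have "finite {Q. feasible J w Q}" by (rule finite_subset) simp
  then have "OPT J w \<in> card ` {Q. feasible J w Q}"
    unfolding OPT_def using feasible_final[OF J w] by (intro Min_in) auto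
  then show ?thesis using card_final_upper_half[OF D w] by auto
qed

lemma ALG_le_card_final:
  assumes J: "minset_instance J" and w: "w \<in> realizations J"
  shows "ALG widest_first J w \<le> card (final J w)"
proof -
  obtain j where "final J w = queried widest_first J w j" "card (final J w) = j"
    using settled_final(2)[OF J] by blast
  then show ?thesis unfolding ALG_def using feasible_final[OF J w] by (intro Least_le) simp
qed

section \<open>Independence of the decision to query \<open>i\<close> from the value of
  \<open>i\<close>\<close>

lemma run_mono: "run J w k \<subseteq> run J w (Suc k)"
  by (auto simp: step_def)

text \<open>Minimizers depend only on revealed values, so changing \<open>w i\<close> has no effect
  before \<open>i\<close> is queried. Both runs therefore coincide until \<open>i\<close> enters
  both of them, and from then on monotonicity keeps it there.\<close>

lemma run_fun_upd:
  "run J (w(i := y)) k = run J w k \<or> i \<in> run J w k \<and> i \<in> run J (w(i := y)) k"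
proof (induction k)
  case (Suc k)
  show ?case
  proof (cases "i \<in> run J w k \<and> i \<in> run J (w(i := y)) k")
    case False
    have eq: "run J (w(i := y)) k = run J w k" using Suc.IH False by blast
    have i: "i \<notin> run J w k" using False unfolding eq by blast
    have "minimizers J (w(i := y)) (run J w k) = minimizers J w (run J w k)"
      by (rule minimizers_cong) (use i in auto)
    then show ?thesis by (simp only: run_Suc step_def eq) simp
  next
    case True
    then show ?thesis using run_mono by blast
  qed
qed simp

lemma in_final_fun_upd: "i \<in> final J (w(i := y)) \<longleftrightarrow> i \<in> final J w"
  unfolding final_def using run_fun_upd by blast

section \<open>Measurability of the decisions and of the run\<close>

lemma minimizers_measurable:
  assumes J: "minset_instance J"
  shows "(\<lambda>w. minimizers J w Q) \<in> measurable (PiM (ground J) (\<lambda>_. borel)) (count_space (Pow (family J)))"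
proof -
  let ?P = "PiM (ground J) (\<lambda>_. borel) :: (nat \<Rightarrow> real) measure"
  have fin: "finite (family J)" using instance_finite[OF J] by blast
  have L: "(\<lambda>w. lower_limit J w Q S) \<in> borel_measurable ?P" if "S \<in> family J" for S
    unfolding lower_limit_def using that J
    by (intro borel_measurable_add borel_measurable_sum borel_measurable_const
        measurable_component_singleton) (auto simp: minset_instance_def)
  \<comment> \<open>The target is finite, so preimages of single points suffice. Each is a finite
    Boolean combination of comparisons between lower limits.\<close>
  have "(\<lambda>w. minimizers J w Q) -` {M} \<inter> space ?P \<in> sets ?P" if "M \<subseteq> family J" for M
  proof -
    have "(\<lambda>w. minimizers J w Q) -` {M} \<inter> space ?P = {w \<in> space ?P. \<forall>S\<in>family J.
      (S \<in> M) = (\<forall>S'\<in>family J. lower_limit J w Q S \<le> lower_limit J w Q S')}"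
      using that by (auto simp: minimizers_def)
    also have "\<dots> \<in> sets ?P"
    proof (rule sets.sets_Collect_finite_All[OF _ fin])
      fix S assume S: "S \<in> family J"
      have A: "{w \<in> space ?P. \<forall>S'\<in>family J. lower_limit J w Q S \<le> lower_limit J w Q S'} \<in> sets ?P"
        using L S by (intro sets.sets_Collect_finite_All[OF _ fin] borel_measurable_le) auto
      show "{w \<in> space ?P. (S \<in> M) =
          (\<forall>S'\<in>family J. lower_limit J w Q S \<le> lower_limit J w Q S')} \<in> sets ?P"
        using A sets.sets_Collect_neg[OF A] by (cases "S \<in> M") simp_all
    qed
    finally show ?thesis .
  qed
  then show ?thesis using fin minimizers_subset by (subst measurable_count_space_eq2) auto
qed

lemma minimizers_function_measurable:
  assumes J: "minset_instance J"
  shows "(\<lambda>w. f (minimizers J w Q)) \<in> measurable (PiM (ground J) (\<lambda>_. borel)) (count_space UNIV)"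
  by (rule measurable_compose[OF minimizers_measurable[OF J]]) simp

lemma measurable_count_space_restrict:
  assumes "f \<in> measurable M (count_space UNIV)" "\<And>x. x \<in> space M \<Longrightarrow> f x \<in> A"
  shows "f \<in> measurable M (count_space A)"
  using assms by (auto simp: measurable_def Pi_iff)

text \<open>The previous query set takes finitely many values. With this value fixed, the next query
  set is a function of the minimizers, and the finitely many pieces are glued by countable
  composition.\<close>

lemma queried_measurable:
  assumes J: "minset_instance J"
  shows "(\<lambda>w. queried widest_first J w k)
    \<in> measurable (PiM (ground J) (\<lambda>_. borel)) (count_space (Pow (ground J)))"
proof (induction k)
  case 0
  then show ?case by (simp add: queried_def)
next
  case (Suc k)
  show ?case unfolding queried_Suc
    by (rule measurable_compose_countable'[OF _ Suc])
      (use pick_in_ground[OF J minimizers_subset] in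
        \<open>auto intro!: measurable_count_space_restrict countable_finite
          minimizers_function_measurable[OF J, of "\<lambda>M. insert (pick J Q M) Q" Q for Q]\<close>)
qed

lemma run_measurable:
  assumes J: "minset_instance J"
  shows "(\<lambda>w. run J w k)
    \<in> measurable (PiM (ground J) (\<lambda>_. borel)) (count_space (Pow (ground J)))"
proof (induction k)
  case 0
  then show ?case by simp
next
  case (Suc k)
  have "(\<lambda>w. step J w Q) \<in> measurable (PiM (ground J) (\<lambda>_. borel)) (count_space (Pow (ground J)))"
    if "Q \<in> Pow (ground J)" for Q
  proof (rule measurable_count_space_restrict)
    show "(\<lambda>w. step J w Q) \<in> measurable (PiM (ground J) (\<lambda>_. borel)) (count_space UNIV)"
      unfolding step_def
      by (rule minimizers_function_measurable[OF J,
            of "\<lambda>M. if settled J Q M then Q else insert (pick J Q M) Q"])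
    show "step J w Q \<in> Pow (ground J)" for w
      using that pick_in_ground[OF J minimizers_subset] by (simp add: step_def)
  qed
  then show ?case unfolding run_Suc
    by (rule measurable_compose_countable'[OF _ Suc]) (auto intro: countable_finite)
qed

text \<open>The measure is left open up to its measurable sets, since the lemma is applied both to
  the product of the \<open>d i\<close> and to the product with coordinate \<open>i\<close> split
  off.\<close>

lemma final_measurable:
  assumes J: "minset_instance J" and i: "i \<in> ground J"
    and M: "sets M = sets (PiM (ground J) (\<lambda>_. borel))"
  shows "(\<lambda>w. indicator {w. i \<in> final J w} w :: ennreal) \<in> borel_measurable M"
    and "(\<lambda>w. indicator {w. i \<in> final J w \<inter> upper_half J w} w :: ennreal) \<in> borel_measurable M"
proof -
  have F [measurable]: "Measurable.pred M (\<lambda>w. i \<in> final J w)"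
    unfolding measurable_cong_sets[OF M refl] final_def
    by (rule measurable_compose[OF run_measurable[OF J]]) simp
  have [measurable]: "(\<lambda>w. w i) \<in> borel_measurable M"
    unfolding measurable_cong_sets[OF M refl] using i by simp
  have "Measurable.pred M (\<lambda>w. i \<in> final J w \<inter> upper_half J w)"
    unfolding upper_half_def Int_iff mem_Collect_eq by measurable
  then show "(\<lambda>w. indicator {w. i \<in> final J w \<inter> upper_half J w} w :: ennreal) \<in> borel_measurable M"
    by simp
  show "(\<lambda>w. indicator {w. i \<in> final J w} w :: ennreal) \<in> borel_measurable M"
    using F by simp
qed

lemma algorithm_for_widest_first: "algorithm_for {J. disjoint_minset_instance J} widest_first"
proof -
  have "algorithm_for {J} widest_first" if J: "minset_instance J" for J
    unfolding algorithm_for_def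
  proof (intro ballI conjI allI)
    fix J' k assume "J' \<in> {J}"
    then have J': "J' = J" by simp
    show "widest_first J' h \<in> ground J'" for h
      unfolding J' widest_first_def by (rule pick_in_ground[OF J minimizers_subset])
    show "\<exists>k. feasible J' w (queried widest_first J' w k)" if "w \<in> realizations J'" for w
      using feasible_final[OF J] settled_final(2)[OF J] that unfolding J' by metis
    show "(\<lambda>w. widest_first J' (history widest_first J' w k))
       \<in> measurable (PiM (ground J') (\<lambda>_. borel)) (count_space UNIV)"
      unfolding J' widest_first_history
      by (rule measurable_compose_countable'[OF minimizers_function_measurable[OF J] queried_measurable[OF J]])
        (auto intro: countable_finite)
  qed
  then show ?thesis by (auto simp: algorithm_for_def disjoint_minset_instance_def)
qed

section \<open>From realizations to expectations\<close>

lemma AE_realizations: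
  assumes d: "value_distributions J d"
  shows "AE w in PiM (ground J) d. w \<in> realizations J"
proof -
  have "AE w in PiM (ground J) d. \<forall>i\<in>ground J. w i \<in> interval J i"
  proof (intro AE_finite_allI AE_PiM_component finite_ground)
    fix i assume i: "i \<in> ground J"
    then interpret real_distribution "d i" using d by (simp add: value_distributions_def)
    show "AE x in d i. x \<in> interval J i"
      using d i by (intro AE_prob_1) (simp add: value_distributions_def)
  qed (use d in \<open>auto simp: value_distributions_def real_distribution_def\<close>)
  moreover have "AE w in PiM (ground J) d. w \<in> space (PiM (ground J) d)" by (rule AE_space)
  ultimately show ?thesis
    by eventually_elim (auto simp: realizations_def space_PiM PiE_iff)
qed

text \<open>By Fubini the coordinate \<open>i\<close> can be integrated first. Whether
  \<open>i\<close> gets queried does not depend on it, so the inner integral is the probability of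
  an upper-half value, which is at least the balancing parameter.\<close>

lemma queried_upper_half:
  assumes J: "minset_instance J" and d: "value_distributions J d" and i: "i \<in> ground J"
  shows "ennreal (balancing_parameter J d) * (\<integral>\<^sup>+ w. indicator {w. i \<in> final J w} w \<partial>PiM (ground J) d)
    \<le> (\<integral>\<^sup>+ w. indicator {w. i \<in> final J w \<inter> upper_half J w} w \<partial>PiM (ground J) d)"
proof -
  \<comment> \<open>The product locale wants a sigma-finite measure at every index; outside the
    ground set a point mass at 0 is filled in.\<close>
  define e where "e j = (if j \<in> ground J then d j else return borel 0)" for j
  have re: "real_distribution (e j)" for j
    using d prob_space_return[of 0 "borel :: real measure"]
    by (auto simp: e_def value_distributions_def real_distribution_def real_distribution_axioms_def)
  have eb [measurable_cong]: "sets (e j) = sets borel" for j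
    using re real_distribution.events_eq_borel by blast
  have PiM_e: "PiM (ground J) d = PiM (insert i (ground J - {i})) e"
    using i by (intro PiM_cong) (auto simp: e_def)
  have sets_e: "sets (PiM (insert i (ground J - {i})) e) = sets (PiM (ground J) (\<lambda>_. borel))"
    using i eb by (intro sets_PiM_cong) auto
  interpret product_sigma_finite e
    using re by (simp add: product_sigma_finite_def real_distribution_def prob_space_imp_sigma_finite)
  interpret ei: real_distribution "e i" by (rule re)
  let ?I = "ground J - {i}"
  let ?h = "{y. y \<ge> (upper J i + lower J i) / 2}"
  note Fm = final_measurable(1)[OF J i sets_e] and FHm = final_measurable(2)[OF J i sets_e]
  \<comment> \<open>After splitting off coordinate \<open>i\<close>, the first indicator is constant
    in \<open>y\<close>, and the second one is a product of a function of \<open>x\<close> and a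
    function of \<open>y\<close>.\<close>
  have c: "(indicator {w. i \<in> final J w} (x(i := y)) :: ennreal) = indicator {w. i \<in> final J w} x"
    for x y by (simp add: indicator_def in_final_fun_upd)
  have ch: "(indicator {w. i \<in> final J w \<inter> upper_half J w} (x(i := y)) :: ennreal) =
    indicator {w. i \<in> final J w} x * indicator ?h y" for x y
    by (simp add: indicator_def in_final_fun_upd upper_half_def)
  have "balancing_parameter J d \<le> measure (d i) ?h"
    unfolding balancing_parameter_def using i by (intro Min_le imageI finite_imageI finite_ground)
  then have "balancing_parameter J d \<le> measure (e i) ?h" using i by (simp add: e_def)
  then have tau: "ennreal (balancing_parameter J d) \<le> emeasure (e i) ?h"
    unfolding ei.emeasure_eq_measure by (rule ennreal_leI)
  have "ennreal (balancing_parameter J d) * (\<integral>\<^sup>+ w. indicator {w. i \<in> final J w} w \<partial>PiM (ground J) d)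
    = (\<integral>\<^sup>+ w. ennreal (balancing_parameter J d) * indicator {w. i \<in> final J w} w \<partial>PiM (insert i ?I) e)"
    unfolding PiM_e using Fm by (simp add: nn_integral_cmult)
  also have "\<dots> = (\<integral>\<^sup>+ x. \<integral>\<^sup>+ y. ennreal (balancing_parameter J d) * indicator {w. i \<in> final J w} x \<partial>e i \<partial>PiM ?I e)"
    using Fm by (subst product_nn_integral_insert) (auto simp: c)
  also have "\<dots> = (\<integral>\<^sup>+ x. ennreal (balancing_parameter J d) * indicator {w. i \<in> final J w} x \<partial>PiM ?I e)"
    by (simp only: nn_integral_const ei.emeasure_space_1 mult_1_right)
  also have "\<dots> \<le> (\<integral>\<^sup>+ x. indicator {w. i \<in> final J w} x * emeasure (e i) ?h \<partial>PiM ?I e)"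
    using tau by (intro nn_integral_mono) (auto simp: indicator_def)
  also have "\<dots> = (\<integral>\<^sup>+ x. \<integral>\<^sup>+ y. indicator {w. i \<in> final J w} x * indicator ?h y \<partial>e i \<partial>PiM ?I e)"
    by (simp add: nn_integral_cmult_indicator)
  also have "\<dots> = (\<integral>\<^sup>+ w. indicator {w. i \<in> final J w \<inter> upper_half J w} w \<partial>PiM (ground J) d)"
  proof -
    have "finite ?I" "i \<notin> ?I" by auto
    from product_nn_integral_insert[OF this FHm] show ?thesis unfolding PiM_e ch by (rule sym)
  qed
  finally show ?thesis .
qed

lemma card_eq_sum_indicator:
  assumes "A w \<subseteq> G" "finite G"
  shows "(of_nat (card (A w)) :: ennreal) = (\<Sum>i\<in>G. indicator {w. i \<in> A w} w)"
proof -
  have "(\<Sum>i\<in>G. indicator {w. i \<in> A w} w :: ennreal) = (\<Sum>i\<in>G. if i \<in> A w then 1 else 0)"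
    by (intro sum.cong) (auto simp: indicator_def)
  also have "\<dots> = of_nat (card (A w))"
    using assms by (simp add: sum.If_cases Int_absorb1)
  finally show ?thesis by simp
qed

lemma expected_ALG_le:
  assumes D: "disjoint_minset_instance J" and d: "value_distributions J d"
    and pos: "balancing_parameter J d > 0"
  shows "expected J d (ALG widest_first J) \<le> ennreal (2 / balancing_parameter J d) * expected J d (OPT J)"
proof -
  have J: "minset_instance J" using D by (simp add: disjoint_minset_instance_def)
  define \<tau> where "\<tau> = balancing_parameter J d"
  let ?P = "PiM (ground J) d"
  let ?F = "\<lambda>i w. indicator {w. i \<in> final J w} w :: ennreal"
  let ?H = "\<lambda>i w. indicator {w. i \<in> final J w \<inter> upper_half J w} w :: ennreal"
  have sets_d: "sets ?P = sets (PiM (ground J) (\<lambda>_. borel))"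
    using d by (intro sets_PiM_cong) (auto simp: value_distributions_def real_distribution.events_eq_borel)
  note Fm = final_measurable(1)[OF J _ sets_d] and Hm = final_measurable(2)[OF J _ sets_d]
  have sub: "final J w \<subseteq> ground J" for w
    using run_subset_ground[OF J] by (simp add: final_def)
  have half: "ennreal (1 / 2) * of_nat (2 * n) = of_nat n" for n :: nat
  proof -
    have "ennreal (1 / 2) * ennreal (real (2 * n)) = ennreal (1 / 2 * real (2 * n))"
      by (rule ennreal_mult[symmetric]) auto
    also have "1 / 2 * real (2 * n) = real n" by simp
    finally show ?thesis by (simp only: ennreal_of_nat_eq_real_of_nat)
  qed
  have AE: "AE w in ?P. w \<in> realizations J" by (rule AE_realizations[OF d])
  have "expected J d (ALG widest_first J) \<le> (\<integral>\<^sup>+ w. of_nat (card (final J w)) \<partial>?P)"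
    unfolding expected_def using AE
    by (intro nn_integral_mono_AE, eventually_elim) (use ALG_le_card_final[OF J] in simp)
  also have "\<dots> = (\<Sum>i\<in>ground J. \<integral>\<^sup>+ w. ?F i w \<partial>?P)"
    using sub Fm by (simp add: card_eq_sum_indicator[where A="final J" and G="ground J"] nn_integral_sum)
  \<comment> \<open>The factor 1 is written as (1/\<tau>) * \<tau> to bring in
    \<open>queried_upper_half\<close> for each interval.\<close>
  also have "\<dots> = ennreal (1 / \<tau>) * (\<Sum>i\<in>ground J. ennreal \<tau> * (\<integral>\<^sup>+ w. ?F i w \<partial>?P))"
    using pos by (simp add: sum_distrib_left[symmetric] mult.assoc[symmetric]
        ennreal_mult[symmetric] \<tau>_def)
  also have "\<dots> \<le> ennreal (1 / \<tau>) * (\<Sum>i\<in>ground J. \<integral>\<^sup>+ w. ?H i w \<partial>?P)"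
    unfolding \<tau>_def by (intro mult_left_mono sum_mono queried_upper_half[OF J d]) auto
  \<comment> \<open>The factor 1/2 goes to the upper-half count, which is known to be measurable.
    \<open>OPT\<close> then enters only through monotonicity of the integral, which asks for no
    measurability.\<close>
  also have "\<dots> = ennreal (2 / \<tau>) * (ennreal (1 / 2) * (\<Sum>i\<in>ground J. \<integral>\<^sup>+ w. ?H i w \<partial>?P))"
    using pos by (simp add: mult.assoc[symmetric] ennreal_mult[symmetric] \<tau>_def del: ennreal_half)
  also have "ennreal (1 / 2) * (\<Sum>i\<in>ground J. \<integral>\<^sup>+ w. ?H i w \<partial>?P)
    = (\<integral>\<^sup>+ w. ennreal (1 / 2) * of_nat (card (final J w \<inter> upper_half J w)) \<partial>?P)"
  proof -
    have "(\<integral>\<^sup>+ w. ennreal (1 / 2) * of_nat (card (final J w \<inter> upper_half J w)) \<partial>?P) =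
      (\<integral>\<^sup>+ w. ennreal (1 / 2) * (\<Sum>i\<in>ground J. ?H i w) \<partial>?P)"
      using sub by (subst card_eq_sum_indicator[where A="\<lambda>w. final J w \<inter> upper_half J w" and G="ground J"]) auto
    also have "\<dots> = ennreal (1 / 2) * (\<Sum>i\<in>ground J. \<integral>\<^sup>+ w. ?H i w \<partial>?P)"
      using Hm by (subst nn_integral_cmult) (auto simp: nn_integral_sum)
    finally show ?thesis by simp
  qed
  also have "\<dots> \<le> expected J d (OPT J)"
    unfolding expected_def using AE
  proof (intro nn_integral_mono_AE, eventually_elim)
    fix w assume "w \<in> realizations J"
    then have "(of_nat (card (final J w \<inter> upper_half J w)) :: ennreal) \<le> of_nat (2 * OPT J w)"
      using card_final_upper_half_le_OPT[OF D] of_nat_mono by blast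
    then have "ennreal (1 / 2) * of_nat (card (final J w \<inter> upper_half J w))
      \<le> ennreal (1 / 2) * of_nat (2 * OPT J w)" by (intro mult_left_mono) auto
    then show "ennreal (1 / 2) * of_nat (card (final J w \<inter> upper_half J w)) \<le> of_nat (OPT J w)"
      unfolding half .
  qed
  finally show ?thesis unfolding \<tau>_def by (simp add: mult_left_mono)
qed

theorem theorem3:
  shows "\<exists>A. algorithm_for {J. disjoint_minset_instance J} A \<and>
    (\<forall>J d. disjoint_minset_instance J \<longrightarrow> value_distributions J d \<longrightarrow>
       balancing_parameter J d > 0 \<longrightarrow>
       expected J d (ALG A J) \<le> ennreal (2 / balancing_parameter J d) * expected J d (OPT J))"
  using algorithm_for_widest_first expected_ALG_le by blast

end
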